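(* There exist absolute constants $C>0$, $D>0$ and $\ell_0$ such that the following holds. Let $\ell$ and $u\ge \ell$ be integers, let $n:=2^\ell$, and let $S\subseteq \mathbb{F}_2^u$ have size $n$. Let $h:\mathbb{F}_2^u\to\mathbb{F}_2^\ell$ be a uniformly random linear map. Then for every real $R>1$ satisfying \[ R\,\ell^{1-1/R}\ge D\ln \ell \] and every $\ell\ge \ell_0$, \[ \Pr_h\left[\mathsf M(S,h)\ge R\frac{\ell}{\log\ell}\right]\le C\,\frac{(\ln\ell)^2}{R^2\,\ell^{2-2/R}}. \]
   Context: All logarithms $\log$ are base $2$; $\ln$ is the natural logarithm. For a linear map $h:\mathbb{F}_2^u\to\mathbb{F}_2^\ell$ and $S\subseteq\mathbb{F}_2^u$, the load of $y\in\mathbb{F}_2^\ell$ is $\operatorname{load}_h(y):=|h^{-1}(y)\cap S|$, and the maximum load is $\mathsf M(S,h):=\max_{y\in\mathbb{F}_2^\ell}\operatorname{load}_h(y)$. A uniformly random linear map $\mathbb{F}_2^u\to\mathbb{F}_2^\ell$ is one chosen uniformly among all linear maps (equivalently, given by a uniformly random $\ell\times u$ binary matrix). *)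

theory Defs
  imports "HOL-Probability.Probability"
begin

text \<open>Vectors of F_2^u are represented as functions nat => bool that vanish
  outside the coordinates 0..u-1.\<close>
definition vecs :: "nat \<Rightarrow> (nat \<Rightarrow> bool) set" where
  "vecs u = {x. \<forall>i. u \<le> i \<longrightarrow> \<not> x i}"

definition mats :: "nat \<Rightarrow> nat \<Rightarrow> (nat \<Rightarrow> nat \<Rightarrow> bool) set" where
  "mats l u = {A. \<forall>i j. (l \<le> i \<or> u \<le> j) \<longrightarrow> \<not> A i j}"

definition matvec :: "nat \<Rightarrow> nat \<Rightarrow> (nat \<Rightarrow> nat \<Rightarrow> bool) \<Rightarrow> (nat \<Rightarrow> bool) \<Rightarrow> (nat \<Rightarrow> bool)" where
  "matvec l u A x = (\<lambda>i. i < l \<and> odd (card {j. j < u \<and> A i j \<and> x j}))"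

definition load :: "nat \<Rightarrow> nat \<Rightarrow> (nat \<Rightarrow> bool) set \<Rightarrow> (nat \<Rightarrow> nat \<Rightarrow> bool) \<Rightarrow> (nat \<Rightarrow> bool) \<Rightarrow> nat" where
  "load l u S A y = card {x \<in> S. matvec l u A x = y}"

definition max_load :: "nat \<Rightarrow> nat \<Rightarrow> (nat \<Rightarrow> bool) set \<Rightarrow> (nat \<Rightarrow> nat \<Rightarrow> bool) \<Rightarrow> nat" where
  "max_load l u S A = Max ((load l u S A) ` vecs l)"

end

theory Submission
  imports Defs
begin

text \<open>
  Fix \<open>a > 1\<close> and follow the exponential potential, the average of \<open>a ^ load\<close>, while the
  columns of the random matrix are exposed one at a time. The map \<open>x \<mapsto> A x\<close> on
  \<open>F_2^u\<close> is the restriction to \<open>0 \<times> F_2^u\<close> of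
  \<open>(y, x) \<mapsto> y + A x\<close>. The latter is a composition of \<open>u\<close> maps, each of which deletes the
  last coordinate and adds an independent uniform vector if that coordinate was 1.
  If the potential is \<open>1 + Y\<close> before such a step, it is \<open>1 + 2 * Y + Q\<close> after it, where
  \<open>Q \<ge> 0\<close> has mean at most \<open>Y\<^sup>2\<close>. Let \<open>p\<close> be the probability that the final potential is at
  least \<open>exp r\<close> when \<open>n\<close> steps remain. Applying Jensen's inequality to the power
  \<open>1 / 2^n\<close> of the final potential gives the bound \<open>Y / (exp (r / 2^n) - 1)\<close> for \<open>p\<close>.
  Feeding this bound into an induction on \<open>n\<close> gives the quadratic bound
  \<open>p \<le> 4 * (2^n * Y / r)\<^sup>2\<close>. Initially \<open>2^u * Y = a - 1\<close>, and
  \<open>a = exp 1 * l powr (1 / R)\<close> makes a load of \<open>r = R * l / log 2 l\<close> force the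
  final potential to be at least \<open>exp r\<close>.
\<close>

section \<open>Vectors over the two-element field\<close>

definition vadd :: "(nat \<Rightarrow> bool) \<Rightarrow> (nat \<Rightarrow> bool) \<Rightarrow> nat \<Rightarrow> bool" where
  "vadd x y = (\<lambda>i. x i \<noteq> y i)"

lemma vadd_in_vecs: "x \<in> vecs n \<Longrightarrow> y \<in> vecs n \<Longrightarrow> vadd x y \<in> vecs n"
  by (auto simp: vadd_def vecs_def)

lemma vadd_vadd_cancel [simp]: "vadd x (vadd x y) = y"
  by (auto simp: vadd_def)

lemma vadd_commute: "vadd x y = vadd y x"
  by (auto simp: vadd_def)

lemma bij_betw_vadd: "x \<in> vecs n \<Longrightarrow> bij_betw (vadd x) (vecs n) (vecs n)"
  by (rule bij_betw_byWitness[where f' = "vadd x"]) (auto intro: vadd_in_vecs)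

lemma vecs_0: "vecs 0 = {\<lambda>_. False}"
  by (auto simp: vecs_def)

lemma vecs_Suc: "vecs (Suc n) = vecs n \<union> (\<lambda>x. x(n := True)) ` vecs n"
proof (intro equalityI subsetI)
  fix x assume x: "x \<in> vecs (Suc n)"
  show "x \<in> vecs n \<union> (\<lambda>x. x(n := True)) ` vecs n"
  proof (cases "x n")
    case True
    then have "x = (x(n := False))(n := True)" "x(n := False) \<in> vecs n"
      using x by (auto simp: vecs_def Suc_le_eq fun_eq_iff)
    then show ?thesis by blast
  next
    case False
    then have "x \<in> vecs n"
      using x unfolding vecs_def by (auto simp: Suc_le_eq) (metis le_neq_implies_less)
    then show ?thesis by blast
  qed
qed (auto simp: vecs_def)

lemma vecs_Suc_disjoint: "vecs n \<inter> (\<lambda>x. x(n := True)) ` vecs n = {}"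
  by (auto simp: vecs_def)

lemma inj_on_upd_last: "inj_on (\<lambda>x. x(n := True)) (vecs n)"
proof (rule inj_onI, rule ext)
  fix x y i assume "x \<in> vecs n" "y \<in> vecs n" "x(n := True) = y(n := True)"
  then show "x i = y i"
    by (cases "i = n") (auto simp: vecs_def dest: fun_cong[where x = i])
qed

lemma finite_vecs [simp]: "finite (vecs n)"
  by (induction n) (simp_all add: vecs_0 vecs_Suc)

lemma sum_vecs_Suc:
  "sum f (vecs (Suc n)) = (\<Sum>x\<in>vecs n. f x) + (\<Sum>x\<in>vecs n. f (x(n := True)))"
  by (simp add: vecs_Suc sum.union_disjoint vecs_Suc_disjoint sum.reindex inj_on_upd_last)

lemma prod_vecs_Suc:
  "prod f (vecs (Suc n)) = (\<Prod>x\<in>vecs n. f x) * (\<Prod>x\<in>vecs n. f (x(n := True)))"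
  by (simp add: vecs_Suc prod.union_disjoint vecs_Suc_disjoint prod.reindex inj_on_upd_last)

lemma card_vecs: "card (vecs n) = 2 ^ n"
proof (induction n)
  case (Suc n)
  have "card (vecs (Suc n)) = (\<Sum>x\<in>vecs (Suc n). 1)" by simp
  also have "\<dots> = 2 ^ Suc n"
    using Suc unfolding sum_vecs_Suc by simp
  finally show ?case .
qed (simp add: vecs_0)

section \<open>Matrix-vector products and columns of matrices\<close>

lemma matvec_Suc:
  "matvec l (Suc n) A x = vadd (matvec l n A x) (\<lambda>i. i < l \<and> A i n \<and> x n)"
proof
  fix i
  have "{j. j < Suc n \<and> A i j \<and> x j} =
      {j. j < n \<and> A i j \<and> x j} \<union> (if A i n \<and> x n then {n} else {})"
    by (auto simp: less_Suc_eq)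
  moreover have "finite {j. j < n \<and> A i j \<and> x j}" by simp
  ultimately show "matvec l (Suc n) A x i = vadd (matvec l n A x) (\<lambda>i. i < l \<and> A i n \<and> x n) i"
    by (auto simp: matvec_def vadd_def card_insert_if)
qed

lemma matvec_vadd: "matvec l n A (vadd x y) = vadd (matvec l n A x) (matvec l n A y)"
proof (induction n)
  case 0
  show ?case by (auto simp: matvec_def vadd_def)
next
  case (Suc n)
  show ?case by (auto simp: matvec_Suc Suc fun_eq_iff) (auto simp: vadd_def)
qed

lemma matvec_in_vecs: "matvec l n A x \<in> vecs l"
  by (auto simp: matvec_def vecs_def)

lemma matvec_cong:
  assumes "\<And>i j. j < n \<Longrightarrow> A i j = B i j" "\<And>j. j < n \<Longrightarrow> x j = y j"
  shows "matvec l n A x = matvec l n B y"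
proof -
  have "{j. j < n \<and> A i j \<and> x j} = {j. j < n \<and> B i j \<and> y j}" for i
    using assms by auto
  then show ?thesis by (simp add: matvec_def)
qed

definition add_col :: "nat \<Rightarrow> (nat \<Rightarrow> nat \<Rightarrow> bool) \<Rightarrow> (nat \<Rightarrow> bool) \<Rightarrow> nat \<Rightarrow> nat \<Rightarrow> bool" where
  "add_col n A c = (\<lambda>i j. if j = n then c i else A i j)"

lemma matvec_add_col:
  assumes "c \<in> vecs l" "x \<in> vecs n"
  shows "matvec l (Suc n) (add_col n A c) x = matvec l n A x"
    and "matvec l (Suc n) (add_col n A c) (x(n := True)) = vadd (matvec l n A x) c"
proof -
  have "matvec l n (add_col n A c) x = matvec l n A x"
    by (rule matvec_cong) (auto simp: add_col_def)
  moreover have "\<not> x n" using assms(2) by (simp add: vecs_def)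
  ultimately show "matvec l (Suc n) (add_col n A c) x = matvec l n A x"
    by (simp add: matvec_Suc vadd_def)
  have "matvec l n (add_col n A c) (x(n := True)) = matvec l n A x"
    by (rule matvec_cong) (auto simp: add_col_def)
  moreover have "(\<lambda>i. i < l \<and> c i) = c"
    using assms(1) by (auto simp: vecs_def fun_eq_iff not_less[symmetric])
  ultimately show "matvec l (Suc n) (add_col n A c) (x(n := True)) = vadd (matvec l n A x) c"
    by (simp add: matvec_Suc add_col_def)
qed

lemma mats_0: "mats l 0 = {\<lambda>_ _. False}"
  by (auto simp: mats_def)

text \<open>Exposing columns one at a time rests on this: a uniform matrix with \<open>n + 1\<close>
  columns is an independent uniform pair of a matrix with \<open>n\<close> columns and a last
  column.\<close>

lemma bij_betw_add_col:
  "bij_betw (\<lambda>(A, c). add_col n A c) (mats l n \<times> vecs l) (mats l (Suc n))"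
proof (rule bij_betw_byWitness[where
      f' = "\<lambda>A. (\<lambda>i j. j \<noteq> n \<and> A i j, \<lambda>i. A i n)"])
  show "(\<lambda>(A, c). add_col n A c) ` (mats l n \<times> vecs l) \<subseteq> mats l (Suc n)"
    by (auto simp: add_col_def mats_def vecs_def)
  show "(\<lambda>A. (\<lambda>i j. j \<noteq> n \<and> A i j, \<lambda>i. A i n)) ` mats l (Suc n) \<subseteq> mats l n \<times> vecs l"
    by (auto simp: mats_def vecs_def)
  show "\<forall>p\<in>mats l n \<times> vecs l. (\<lambda>i j. j \<noteq> n \<and> (case p of (A, c) \<Rightarrow> add_col n A c) i j,
      \<lambda>i. (case p of (A, c) \<Rightarrow> add_col n A c) i n) = p"
    by (auto simp: add_col_def mats_def fun_eq_iff)
qed (auto simp: add_col_def fun_eq_iff)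

lemma finite_mats [simp]: "finite (mats l n)"
proof (induction n)
  case (Suc n)
  then show ?case using bij_betw_finite[OF bij_betw_add_col[of n l]] by simp
qed (simp add: mats_0)

lemma sum_mats_Suc:
  "sum f (mats l (Suc n)) = (\<Sum>A\<in>mats l n. \<Sum>c\<in>vecs l. f (add_col n A c))"
  using sum.reindex_bij_betw[OF bij_betw_add_col[of n l], of f]
  by (simp add: sum.cartesian_product case_prod_unfold)

lemma card_mats: "card (mats l n) = 2 ^ (l * n)"
proof (induction n)
  case (Suc n)
  have "card (mats l (Suc n)) = card (mats l n) * card (vecs l)"
    using bij_betw_same_card[OF bij_betw_add_col[of n l]] by (simp add: card_cartesian_product)
  then show ?case using Suc by (simp add: card_vecs power_add)
qed (simp add: mats_0)

lemma mats_nonempty: "mats l n \<noteq> {}"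
  by (auto simp: mats_def)

section \<open>Averages over pairs of vectors\<close>

definition avg :: "nat \<Rightarrow> nat \<Rightarrow> ((nat \<Rightarrow> bool) \<Rightarrow> (nat \<Rightarrow> bool) \<Rightarrow> real) \<Rightarrow> real" where
  "avg l n F = (\<Sum>y\<in>vecs l. \<Sum>x\<in>vecs n. F y x) / 2 ^ (l + n)"

lemma avg_const [simp]: "avg l n (\<lambda>_ _. c) = c"
  by (simp add: avg_def card_vecs power_add)

lemma avg_add: "avg l n (\<lambda>y x. F y x + G y x) = avg l n F + avg l n G"
  by (simp add: avg_def sum.distrib add_divide_distrib)

lemma avg_cmult: "avg l n (\<lambda>y x. c * F y x) = c * avg l n F"
  by (simp add: avg_def sum_distrib_left)

lemma avg_mono:
  "(\<And>y x. y \<in> vecs l \<Longrightarrow> x \<in> vecs n \<Longrightarrow> F y x \<le> G y x) \<Longrightarrow> avg l n F \<le> avg l n G"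
  by (auto simp: avg_def intro!: divide_right_mono sum_mono)

lemma avg_Suc:
  "avg l (Suc n) g = (avg l n g + avg l n (\<lambda>y x. g y (x(n := True)))) / 2"
  by (simp add: avg_def sum_vecs_Suc sum.distrib field_simps)

lemma avg_shift:
  assumes "b \<in> vecs l" "w \<in> vecs n"
  shows "avg l n (\<lambda>y x. F (vadd b y) (vadd w x)) = avg l n F"
proof -
  have "(\<Sum>x\<in>vecs n. F y (vadd w x)) = (\<Sum>x\<in>vecs n. F y x)" for y
    by (rule sum.reindex_bij_betw[OF bij_betw_vadd[OF assms(2)]])
  moreover have "(\<Sum>y\<in>vecs l. G (vadd b y)) = (\<Sum>y\<in>vecs l. G y)" for G :: "_ \<Rightarrow> real"
    by (rule sum.reindex_bij_betw[OF bij_betw_vadd[OF assms(1)]])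
  ultimately show ?thesis by (simp add: avg_def)
qed

lemma avg_swap: "avg l n (\<lambda>b w. avg k m (\<lambda>y x. F b w y x)) = avg k m (\<lambda>y x. avg l n (\<lambda>b w. F b w y x))"
proof -
  have "(\<Sum>b\<in>vecs l. \<Sum>w\<in>vecs n. \<Sum>y\<in>vecs k. \<Sum>x\<in>vecs m. F b w y x)
      = (\<Sum>y\<in>vecs k. \<Sum>x\<in>vecs m. \<Sum>b\<in>vecs l. \<Sum>w\<in>vecs n. F b w y x)"
    unfolding sum.cartesian_product
    by (rule sum.reindex_bij_witness[where i = "\<lambda>(y, x, b, w). (b, w, y, x)"
          and j = "\<lambda>(b, w, y, x). (y, x, b, w)"]) auto
  then show ?thesis by (simp add: avg_def flip: sum_divide_distrib)
qed

text \<open>For fixed \<open>y\<close> and \<open>x\<close>, the pair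
  \<open>(vadd b y, vadd w x)\<close> is uniform when \<open>(b, w)\<close> is. After exchanging the
  two averages, \<open>q\<close> therefore averages out independently of \<open>p\<close>.\<close>

lemma avg_convolution:
  "avg l n (\<lambda>b w. avg l n (\<lambda>y x. p y x * q (vadd b y) (vadd w x))) = avg l n p * avg l n q"
proof -
  have "avg l n (\<lambda>b w. avg l n (\<lambda>y x. p y x * q (vadd b y) (vadd w x)))
      = avg l n (\<lambda>y x. avg l n (\<lambda>b w. p y x * q (vadd b y) (vadd w x)))"
    by (rule avg_swap)
  also have "\<dots> = avg l n (\<lambda>y x. avg l n q * p y x)"
  proof -
    have "avg l n (\<lambda>b w. p y x * q (vadd b y) (vadd w x)) = avg l n q * p y x"
      if "y \<in> vecs l" "x \<in> vecs n" for y x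
      using avg_shift[OF that, of q] by (simp add: avg_cmult vadd_commute)
    then show ?thesis by (simp add: avg_def)
  qed
  finally show ?thesis by (simp add: avg_cmult)
qed

section \<open>The potential under one step\<close>

text \<open>Consider the map that deletes the last coordinate and adds \<open>(b, w)\<close> if it
  was 1. Its fibre over \<open>(y, x)\<close> consists of \<open>(y, x)\<close> with last coordinate
  0 and \<open>(b + y, w + x)\<close> with last coordinate 1. The new function multiplies
  \<open>g\<close> over these fibres.\<close>

definition halve ::
  "nat \<Rightarrow> (nat \<Rightarrow> bool) \<Rightarrow> (nat \<Rightarrow> bool) \<Rightarrow> ((nat \<Rightarrow> bool) \<Rightarrow> (nat \<Rightarrow> bool) \<Rightarrow> real) \<Rightarrow>
    (nat \<Rightarrow> bool) \<Rightarrow> (nat \<Rightarrow> bool) \<Rightarrow> real" where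
  "halve n b w g = (\<lambda>y x. g y x * g (vadd b y) ((vadd w x)(n := True)))"

text \<open>The final potential: with \<open>g y x\<close> equal to \<open>a\<close> on \<open>0 \<times> S\<close> and to 1 elsewhere, the product
  at \<open>y\<close> is \<open>a\<close> to the load of \<open>y\<close>.\<close>
definition fmean ::
  "nat \<Rightarrow> nat \<Rightarrow> ((nat \<Rightarrow> bool) \<Rightarrow> (nat \<Rightarrow> bool) \<Rightarrow> real) \<Rightarrow> (nat \<Rightarrow> nat \<Rightarrow> bool) \<Rightarrow> real" where
  "fmean l n g A = (\<Sum>y\<in>vecs l. \<Prod>x\<in>vecs n. g (vadd y (matvec l n A x)) x) / 2 ^ l"

lemma fmean_0: "fmean l 0 g A = avg l 0 g"
proof -
  have "matvec l 0 A x = (\<lambda>_. False)" for x by (simp add: matvec_def)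
  then show ?thesis by (simp add: fmean_def avg_def vecs_0 vadd_def)
qed

text \<open>On the half with last coordinate 1, replacing \<open>x\<close> by \<open>w + x\<close>
  cancels the \<open>A w\<close> in the column, since
  \<open>A (w + x) + b + A w = A x + b\<close>.\<close>

lemma fmean_add_col:
  assumes b: "b \<in> vecs l" and w: "w \<in> vecs n"
  shows "fmean l (Suc n) g (add_col n A (vadd b (matvec l n A w))) = fmean l n (halve n b w g) A"
proof -
  let ?c = "vadd b (matvec l n A w)"
  have c: "?c \<in> vecs l" using b by (simp add: vadd_in_vecs matvec_in_vecs)
  have "(\<Prod>x\<in>vecs (Suc n). g (vadd y (matvec l (Suc n) (add_col n A ?c) x)) x)
      = (\<Prod>x\<in>vecs n. halve n b w g (vadd y (matvec l n A x)) x)" for y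
  proof -
    have "(\<Prod>x\<in>vecs (Suc n). g (vadd y (matvec l (Suc n) (add_col n A ?c) x)) x)
      = (\<Prod>x\<in>vecs n. g (vadd y (matvec l n A x)) x) *
        (\<Prod>x\<in>vecs n. g (vadd y (vadd (matvec l n A x) ?c)) (x(n := True)))"
      unfolding prod_vecs_Suc using c by (simp add: matvec_add_col)
    also have "(\<Prod>x\<in>vecs n. g (vadd y (vadd (matvec l n A x) ?c)) (x(n := True)))
      = (\<Prod>x\<in>vecs n. g (vadd y (vadd (matvec l n A (vadd w x)) ?c)) ((vadd w x)(n := True)))"
      by (rule prod.reindex_bij_betw[OF bij_betw_vadd[OF w], symmetric])
    also have "\<dots> = (\<Prod>x\<in>vecs n. g (vadd b (vadd y (matvec l n A x))) ((vadd w x)(n := True)))"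
    proof -
      have "vadd y (vadd (matvec l n A (vadd w x)) ?c) = vadd b (vadd y (matvec l n A x))" for x
        unfolding matvec_vadd by (auto simp: vadd_def)
      then show ?thesis by simp
    qed
    finally show ?thesis by (simp add: halve_def prod.distrib)
  qed
  then show ?thesis by (simp add: fmean_def)
qed

section \<open>Tail probabilities and their recursion\<close>

definition tail ::
  "nat \<Rightarrow> real \<Rightarrow> nat \<Rightarrow> ((nat \<Rightarrow> bool) \<Rightarrow> (nat \<Rightarrow> bool) \<Rightarrow> real) \<Rightarrow> real" where
  "tail l t n g = (\<Sum>A\<in>mats l n. of_bool (t \<le> fmean l n g A)) / 2 ^ (l * n)"

lemma tail_0: "tail l t 0 g = of_bool (t \<le> avg l 0 g)"
  by (simp add: tail_def mats_0 fmean_0)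

text \<open>For every fixed \<open>w\<close>, the last column \<open>c\<close> is uniform iff \<open>b = c + A w\<close> is, where \<open>A\<close> consists of
  the other columns; averaging over \<open>w\<close> turns \<open>(b, w)\<close> into a uniform shift.\<close>
lemma tail_Suc: "tail l t (Suc n) g = avg l n (\<lambda>b w. tail l t n (halve n b w g))"
proof -
  define I where "I = (\<lambda>n g A. of_bool (t \<le> fmean l n g A) :: real)"
  have eq: "(\<Sum>A\<in>mats l (Suc n). I (Suc n) g A)
      = (\<Sum>b\<in>vecs l. \<Sum>A\<in>mats l n. I n (halve n b w g) A)" if w: "w \<in> vecs n" for w
  proof -
    have "(\<Sum>A\<in>mats l (Suc n). I (Suc n) g A)
        = (\<Sum>A\<in>mats l n. \<Sum>c\<in>vecs l. I (Suc n) g (add_col n A c))"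
      by (rule sum_mats_Suc)
    also have "\<dots> = (\<Sum>A\<in>mats l n. \<Sum>b\<in>vecs l. I (Suc n) g (add_col n A (vadd (matvec l n A w) b)))"
      by (intro sum.cong refl sum.reindex_bij_betw[symmetric] bij_betw_vadd matvec_in_vecs)
    also have "\<dots> = (\<Sum>A\<in>mats l n. \<Sum>b\<in>vecs l. I n (halve n b w g) A)"
      by (intro sum.cong refl) (simp add: I_def vadd_commute[of "matvec l n _ w"] fmean_add_col w)
    finally show ?thesis by (simp add: sum.swap[of _ "vecs l"])
  qed
  have "2 ^ n * (\<Sum>A\<in>mats l (Suc n). I (Suc n) g A)
      = (\<Sum>w\<in>vecs n. \<Sum>A\<in>mats l (Suc n). I (Suc n) g A)"
    by (simp add: card_vecs)
  also have "\<dots> = (\<Sum>w\<in>vecs n. \<Sum>b\<in>vecs l. \<Sum>A\<in>mats l n. I n (halve n b w g) A)"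
    using eq by simp
  also have "\<dots> = (\<Sum>b\<in>vecs l. \<Sum>w\<in>vecs n. \<Sum>A\<in>mats l n. I n (halve n b w g) A)"
    by (rule sum.swap)
  finally have "(\<Sum>A\<in>mats l (Suc n). I (Suc n) g A)
      = (\<Sum>b\<in>vecs l. \<Sum>w\<in>vecs n. \<Sum>A\<in>mats l n. I n (halve n b w g) A) / 2 ^ n"
    by (simp add: field_simps)
  then show ?thesis
    by (simp add: tail_def avg_def I_def power_add flip: sum_divide_distrib)
qed

section \<open>The linear tail bound\<close>

lemma halve_ge_1:
  assumes "\<And>y x. 1 \<le> g y x"
  shows "1 \<le> halve n b w g y x"
  using mult_mono[of 1 "g y x" 1 "g (vadd b y) ((vadd w x)(n := True))"] assms
    order_trans[OF zero_le_one assms]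
  by (simp add: halve_def)

lemma avg_ge_1:
  assumes "\<And>y x. 1 \<le> g y x"
  shows "1 \<le> avg l n g"
  using avg_mono[of l n "\<lambda>_ _. 1" g] assms by simp

text \<open>By concavity the power lies below its tangent at \<open>m\<close>, which is the
  right-hand side.\<close>

lemma powr_le_tangent:
  fixes x m \<theta> :: real
  assumes "0 < x" "0 < m" "0 < \<theta>" "\<theta> \<le> 1"
  shows "x powr \<theta> \<le> m powr \<theta> * (1 - \<theta>) + m powr \<theta> * \<theta> / m * x"
proof -
  have "x powr \<theta> * m powr (1 - \<theta>) \<le> \<theta> * x + (1 - \<theta>) * m"
    using assms by (intro Youngs_inequality_0) auto
  then have "x powr \<theta> * (m / m powr \<theta>) \<le> \<theta> * x + (1 - \<theta>) * m"
    using assms by (simp add: powr_diff)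
  then have "x powr \<theta> \<le> (\<theta> * x + (1 - \<theta>) * m) * (m powr \<theta> / m)"
    using assms by (simp add: field_simps)
  also have "\<dots> = m powr \<theta> * (1 - \<theta>) + m powr \<theta> * \<theta> / m * x"
    using assms by (simp add: field_simps)
  finally show ?thesis .
qed

text \<open>Jensen's inequality for a concave power. Taking the tangent at \<open>m\<close> instead
  of at the average lets any upper bound on the average serve.\<close>

lemma avg_powr_le:
  assumes pos: "\<And>y x. 0 < F y x" and m: "avg l n F \<le> m" "0 < m" and \<theta>: "0 < \<theta>" "\<theta> \<le> 1"
  shows "avg l n (\<lambda>y x. F y x powr \<theta>) \<le> m powr \<theta>"
proof -
  have "avg l n (\<lambda>y x. F y x powr \<theta>)
      \<le> avg l n (\<lambda>y x. m powr \<theta> * (1 - \<theta>) + m powr \<theta> * \<theta> / m * F y x)"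
    using assms by (intro avg_mono powr_le_tangent) auto
  also have "\<dots> = m powr \<theta> * (1 - \<theta>) + m powr \<theta> * \<theta> / m * avg l n F"
    by (simp add: avg_add avg_cmult del: times_divide_eq_left)
  also have "\<dots> \<le> m powr \<theta> * (1 - \<theta>) + m powr \<theta> * \<theta> / m * m"
    using assms by (intro add_left_mono mult_left_mono) auto
  also have "\<dots> = m powr \<theta>"
    using m by (simp add: field_simps)
  finally show ?thesis .
qed

text \<open>The mean after a step is the product of the averages over the two halves, and the
  average before it is their arithmetic mean, so AM-GM applies.\<close>

lemma avg_avg_halve_le:
  "avg l n (\<lambda>b w. avg l n (halve n b w g)) \<le> (avg l (Suc n) g)\<^sup>2"
proof -
  let ?p = "avg l n g" and ?q = "avg l n (\<lambda>y x. g y (x(n := True)))"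
  have "avg l n (\<lambda>b w. avg l n (halve n b w g)) = ?p * ?q"
    unfolding halve_def by (rule avg_convolution[of l n g "\<lambda>y x. g y (x(n := True))"])
  also have "\<dots> \<le> ((?p + ?q) / 2)\<^sup>2"
    using zero_le_power2[of "?p - ?q"] by (simp add: power2_eq_square field_simps)
  finally show ?thesis by (simp add: avg_Suc)
qed

text \<open>A step at most squares the potential in mean, so by Jensen the mean of its power
  \<open>\<theta>\<close> is at most the old potential to the power \<open>2 * \<theta>\<close>.
  Going back through \<open>n\<close> steps turns \<open>\<tau>\<close> into
  \<open>2 ^ n * \<tau>\<close>; the base case is Markov's inequality for the final potential to the
  power \<open>\<tau>\<close>, minus 1.\<close>

lemma tail_le_powr:
  assumes "\<And>y x. 1 \<le> g y x" and "0 < r" "0 < \<tau>" "2 ^ n * \<tau> \<le> 1"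
  shows "tail l (exp r) n g \<le> (avg l n g powr (2 ^ n * \<tau>) - 1) / (exp (r * \<tau>) - 1)"
  using assms(1,4)
proof (induction n arbitrary: g)
  case 0
  let ?X = "avg l 0 g"
  have X: "1 \<le> ?X" by (rule avg_ge_1) (rule 0)
  have e: "exp (r * \<tau>) > 1" using assms by simp
  show ?case
  proof (cases "exp r \<le> ?X")
    case True
    have "exp (r * \<tau>) = exp r powr \<tau>" by (simp add: powr_def mult.commute)
    also have "\<dots> \<le> ?X powr \<tau>" using True assms by (intro powr_mono2) auto
    finally show ?thesis using True e by (simp add: tail_0 field_simps)
  next
    case False
    have "1 \<le> ?X powr \<tau>" using X assms by (simp add: ge_one_powr_ge_zero)
    then show ?thesis using False e by (simp add: tail_0)
  qed
next
  case (Suc n)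
  let ?\<theta> = "2 ^ n * \<tau>" and ?X = "avg l (Suc n) g"
  have X: "1 \<le> ?X" by (rule avg_ge_1) (rule Suc.prems)
  have \<theta>: "0 < ?\<theta>" "?\<theta> \<le> 1" using Suc.prems assms by auto
  have e: "exp (r * \<tau>) > 1" using assms by simp
  have ge: "1 \<le> avg l n (halve n b w g)" for b w
    by (intro avg_ge_1 halve_ge_1 Suc.prems)
  have "tail l (exp r) (Suc n) g
      \<le> avg l n (\<lambda>b w. 1 / (exp (r * \<tau>) - 1) * (avg l n (halve n b w g) powr ?\<theta> + (- 1)))"
    unfolding tail_Suc using \<theta>(2)
    by (intro avg_mono order.trans[OF Suc.IH] halve_ge_1 Suc.prems) auto
  also have "\<dots> = 1 / (exp (r * \<tau>) - 1) * (avg l n (\<lambda>b w. avg l n (halve n b w g) powr ?\<theta>) - 1)"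
    unfolding avg_cmult avg_add by simp
  also have "\<dots> \<le> 1 / (exp (r * \<tau>) - 1) * ((?X\<^sup>2) powr ?\<theta> - 1)"
    using e \<theta> X ge avg_avg_halve_le[of l n g]
    by (intro mult_left_mono diff_right_mono avg_powr_le) (auto intro: less_le_trans[OF zero_less_one])
  also have "(?X\<^sup>2) powr ?\<theta> = ?X powr (2 ^ Suc n * \<tau>)"
  proof -
    have "?X\<^sup>2 = ?X powr 2" using X by (simp add: powr_numeral)
    then have "(?X\<^sup>2) powr ?\<theta> = ?X powr (2 * ?\<theta>)" by (simp only: powr_powr)
    then show ?thesis by (simp add: mult.assoc)
  qed
  finally show ?case by simp
qed

text \<open>With \<open>\<tau> = 1 / 2 ^ n\<close> the exponent of the initial potential becomes
  exactly 1.\<close>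

lemma tail_le_linear:
  assumes "\<And>y x. 1 \<le> g y x" and "0 < r"
  shows "tail l (exp r) n g \<le> (avg l n g - 1) / (exp (r / 2 ^ n) - 1)"
  using tail_le_powr[of g r "1 / 2 ^ n" n l] assms avg_ge_1[of g l n] by simp

section \<open>The quadratic tail bound\<close>

lemma exp_minus_one_ge_cubic:
  fixes x :: real
  assumes "0 \<le> x"
  shows "x + x\<^sup>2 / 2 + x ^ 3 / 6 \<le> exp x - 1"
proof -
  have "(\<Sum>k<4. x ^ k /\<^sub>R fact k) \<le> exp x"
    unfolding exp_def using assms by (intro sum_le_suminf summable_exp_generic) auto
  then show ?thesis
    by (simp add: eval_nat_numeral field_simps)
qed

text \<open>For small \<open>z\<close> the chord of the parabola from \<open>z\<^sub>0\<close> to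
  \<open>z\<close> has slope at most \<open>2 * \<epsilon>\<close>; for large \<open>z\<close> the
  linear bound wins after completing a square. The result is linear in \<open>z - z\<^sub>0\<close>,
  so in the induction, where this difference is \<open>Q\<close>, the mean of \<open>Q\<close>
  suffices and no second moment is required.\<close>

lemma min_quadratic_linear_le:
  fixes p z z\<^sub>0 c \<epsilon> :: real
  assumes "p \<le> c * z\<^sup>2" "p \<le> \<epsilon> * z" "0 \<le> z\<^sub>0" "z\<^sub>0 \<le> z" "0 < c" "0 \<le> \<epsilon>"
  shows "p \<le> c * z\<^sub>0\<^sup>2 + 2 * \<epsilon> * (z - z\<^sub>0)"
proof (cases "c * z \<le> \<epsilon>")
  case True
  have "c * z\<^sup>2 - c * z\<^sub>0\<^sup>2 = c * (z + z\<^sub>0) * (z - z\<^sub>0)"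
    by (simp add: power2_eq_square algebra_simps)
  also have "\<dots> \<le> (2 * \<epsilon>) * (z - z\<^sub>0)"
  proof (rule mult_right_mono)
    have "c * z\<^sub>0 \<le> c * z" using assms by simp
    then show "c * (z + z\<^sub>0) \<le> 2 * \<epsilon>" using True by (simp add: distrib_left)
  qed (use assms in simp)
  finally show ?thesis using assms(1) by simp
next
  case False
  have "0 \<le> (c * z\<^sub>0 - \<epsilon>)\<^sup>2 / c" using assms by simp
  also have "\<dots> = c * z\<^sub>0\<^sup>2 - 2 * \<epsilon> * z\<^sub>0 + \<epsilon> * (\<epsilon> / c)"
    using assms by (simp add: power2_eq_square field_simps)
  finally have sq: "0 \<le> c * z\<^sub>0\<^sup>2 - 2 * \<epsilon> * z\<^sub>0 + \<epsilon> * (\<epsilon> / c)" .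
  have "\<epsilon> * (\<epsilon> / c) \<le> \<epsilon> * z"
    using False assms by (intro mult_left_mono) (auto simp: field_simps)
  then show ?thesis using sq assms(2) by (simp add: algebra_simps)
qed

text \<open>The term \<open>3 / (1 + x)\<close> is chosen so that its increments under \<open>x \<mapsto> x / 2\<close> absorb the
  error terms of the induction (\<open>quad_coeff_step\<close>).\<close>
definition quad_coeff :: "real \<Rightarrow> real" where
  "quad_coeff x = (1 + 3 / (1 + x)) / x\<^sup>2"

lemma quad_coeff_step:
  assumes "0 < x"
  shows "4 * quad_coeff x + 2 / (exp x - 1) \<le> quad_coeff (x / 2)"
proof -
  have pos: "0 < x * (1 + x / 2) * (1 + x)" using assms by simp
  \<comment> \<open>The quadratic and cubic coefficients agree on both sides; only the linear ones,
    1 and 3, differ.\<close>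
  have "x * (1 + x / 2) * (1 + x) \<le> 3 * (x + x\<^sup>2 / 2 + x ^ 3 / 6)"
    using assms by (simp add: power2_eq_square power3_eq_cube field_simps)
  also have "\<dots> \<le> 3 * (exp x - 1)"
    using exp_minus_one_ge_cubic[of x] assms by simp
  finally have "2 / (exp x - 1) \<le> 6 / (x * (1 + x / 2) * (1 + x))"
    using pos assms by (simp add: divide_simps)
  also have "\<dots> = quad_coeff (x / 2) - 4 * quad_coeff x"
    using assms by (simp add: quad_coeff_def divide_simps) (simp add: algebra_simps power2_eq_square)
  finally show ?thesis by simp
qed

text \<open>The main part \<open>2 * Y\<close> of the new excess gives the factor 4 in
  \<open>quad_coeff_step\<close>. The fluctuation \<open>Q\<close> is charged to the linear bound
  and contributes \<open>2 / (exp x - 1)\<close>.\<close>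

lemma tail_le_quadratic:
  assumes "\<And>y x. 1 \<le> g y x" and r: "0 < r"
  shows "tail l (exp r) n g \<le> quad_coeff (r / 2 ^ n) * (avg l n g - 1)\<^sup>2"
  using assms(1)
proof (induction n arbitrary: g)
  case 0
  let ?X = "avg l 0 g"
  show ?case
  proof (cases "exp r \<le> ?X")
    case True
    \<comment> \<open>The probability is 1 here, and \<open>exp r - 1 \<ge> r\<close> makes the
      excess at least \<open>r\<close>; the summand 1 in \<open>quad_coeff\<close> is then
      enough.\<close>
    have "r \<le> ?X - 1" using True exp_ge_add_one_self[of r] by linarith
    then have "r\<^sup>2 \<le> (?X - 1)\<^sup>2" using r by (intro power_mono) auto
    then have "1 \<le> 1 / r\<^sup>2 * (?X - 1)\<^sup>2" using r by (simp add: field_simps)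
    also have "\<dots> \<le> quad_coeff r * (?X - 1)\<^sup>2"
      unfolding quad_coeff_def using r by (intro mult_right_mono divide_right_mono) auto
    finally show ?thesis using True by (simp add: tail_0)
  next
    case False
    then show ?thesis using r by (simp add: tail_0 quad_coeff_def)
  qed
next
  case (Suc n)
  define x where "x = r / 2 ^ n"
  define \<epsilon> where "\<epsilon> = 1 / (exp x - 1)"
  define Y where "Y = avg l (Suc n) g - 1"
  define p where "p = (\<lambda>y x. g y x - 1)"
  define q where "q = (\<lambda>y x. g y (x(n := True)) - 1)"
  define Q where "Q = (\<lambda>b w. avg l n (\<lambda>y x. p y x * q (vadd b y) (vadd w x)))"
  have x: "0 < x" using r by (simp add: x_def)
  have \<epsilon>: "0 < \<epsilon>" using x by (simp add: \<epsilon>_def)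
  have c: "0 < quad_coeff x" using x by (simp add: quad_coeff_def add_pos_pos)
  have p: "0 \<le> p y x" and q: "0 \<le> q y x" for y x using Suc.prems by (auto simp: p_def q_def)
  have Y: "0 \<le> Y" using avg_ge_1[OF Suc.prems] by (simp add: Y_def)
  have Y_eq: "2 * Y = avg l n p + avg l n q"
    using avg_add[of l n p "\<lambda>_ _. 1"] avg_add[of l n q "\<lambda>_ _. 1"]
    by (simp add: Y_def avg_Suc p_def q_def field_simps)
  \<comment> \<open>Expand \<open>(1 + p) * (1 + q)\<close>: the linear terms average to
    \<open>2 * Y\<close> for every shift, so only the cross term \<open>Q\<close> depends on
    \<open>b\<close> and \<open>w\<close>.\<close>
  have halve_eq: "avg l n (halve n b w g) - 1 = 2 * Y + Q b w" if "b \<in> vecs l" "w \<in> vecs n" for b w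
  proof -
    have "halve n b w g
        = (\<lambda>y x. p y x * q (vadd b y) (vadd w x) + (p y x + (q (vadd b y) (vadd w x) + 1)))"
      by (simp add: halve_def p_def q_def fun_eq_iff algebra_simps)
    then show ?thesis
      using that by (simp add: avg_add avg_shift Q_def Y_eq)
  qed
  have Q: "0 \<le> Q b w" for b w
    using avg_mono[of l n "\<lambda>_ _. 0" "\<lambda>y x. p y x * q (vadd b y) (vadd w x)"] p q by (simp add: Q_def)
  have avg_Q: "avg l n Q \<le> Y\<^sup>2"
  proof -
    have "avg l n Q = avg l n p * avg l n q"
      unfolding Q_def by (rule avg_convolution)
    also have "\<dots> \<le> ((avg l n p + avg l n q) / 2)\<^sup>2"
      using zero_le_power2[of "avg l n p - avg l n q"] by (simp add: power2_eq_square field_simps)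
    finally show ?thesis by (simp flip: Y_eq)
  qed
  have "tail l (exp r) (Suc n) g \<le> avg l n (\<lambda>b w. quad_coeff x * (2 * Y)\<^sup>2 + 2 * \<epsilon> * Q b w)"
    unfolding tail_Suc
  proof (rule avg_mono)
    fix b w assume bw: "b \<in> vecs l" "w \<in> vecs n"
    have ge: "1 \<le> halve n b w g y x" for y x by (rule halve_ge_1) (rule Suc.prems)
    have "tail l (exp r) n (halve n b w g)
        \<le> quad_coeff x * (2 * Y)\<^sup>2 + 2 * \<epsilon> * ((2 * Y + Q b w) - 2 * Y)"
    proof (rule min_quadratic_linear_le)
      show "tail l (exp r) n (halve n b w g) \<le> quad_coeff x * (2 * Y + Q b w)\<^sup>2"
        using Suc.IH[of "halve n b w g"] ge by (simp add: halve_eq bw x_def)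
      show "tail l (exp r) n (halve n b w g) \<le> \<epsilon> * (2 * Y + Q b w)"
        using tail_le_linear[of "halve n b w g" r l n] ge r by (simp add: halve_eq bw x_def \<epsilon>_def)
    qed (use Y Q c \<epsilon> in auto)
    then show "tail l (exp r) n (halve n b w g) \<le> quad_coeff x * (2 * Y)\<^sup>2 + 2 * \<epsilon> * Q b w"
      by simp
  qed
  also have "\<dots> = 4 * quad_coeff x * Y\<^sup>2 + 2 * \<epsilon> * avg l n Q"
    by (simp add: avg_add avg_cmult power_mult_distrib)
  also have "\<dots> \<le> 4 * quad_coeff x * Y\<^sup>2 + 2 * \<epsilon> * Y\<^sup>2"
    using avg_Q \<epsilon> by simp
  also have "\<dots> = (4 * quad_coeff x + 2 / (exp x - 1)) * Y\<^sup>2"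
    by (simp add: \<epsilon>_def algebra_simps)
  also have "\<dots> \<le> quad_coeff (x / 2) * Y\<^sup>2"
    by (intro mult_right_mono quad_coeff_step x) auto
  finally show ?case by (simp add: x_def Y_def mult.commute)
qed

section \<open>From the potential to the maximum load\<close>

text \<open>A single \<open>y\<close> of load at least \<open>m\<close> contributes
  \<open>a powr m\<close> to a sum of nonnegative terms, which survives division by
  \<open>2 ^ l\<close> as at least \<open>exp r\<close>.\<close>

lemma prob_max_load_ge:
  fixes a r m :: real
  assumes S: "S \<subseteq> vecs u" "card S = 2 ^ l" and a: "1 \<le> a" and r: "0 < r"
    and m: "exp r * 2 ^ l \<le> a powr m"
  shows "measure_pmf.prob (pmf_of_set (mats l u)) {A. m \<le> real (max_load l u S A)}
    \<le> 4 * (a - 1)\<^sup>2 / r\<^sup>2"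
proof -
  define g :: "(nat \<Rightarrow> bool) \<Rightarrow> (nat \<Rightarrow> bool) \<Rightarrow> real"
    where "g = (\<lambda>y x. if y = (\<lambda>_. False) \<and> x \<in> S then a else 1)"
  have g: "1 \<le> g y x" for y x using a by (simp add: g_def)
  have fmean_g: "fmean l u g A = (\<Sum>y\<in>vecs l. a ^ load l u S A y) / 2 ^ l" for A
  proof -
    have "(\<Prod>x\<in>vecs u. g (vadd y (matvec l u A x)) x) = a ^ load l u S A y" for y
    proof -
      have "vadd y z = (\<lambda>_. False) \<longleftrightarrow> z = y" for z
        by (auto simp: vadd_def fun_eq_iff)
      then have "(\<Prod>x\<in>vecs u. g (vadd y (matvec l u A x)) x)
          = (\<Prod>x\<in>vecs u. if x \<in> {x \<in> S. matvec l u A x = y} then a else 1)"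
        by (auto simp: g_def intro: prod.cong)
      also have "\<dots> = a ^ card (vecs u \<inter> {x \<in> S. matvec l u A x = y})"
        by (simp add: prod.inter_restrict[symmetric] del: mem_Collect_eq)
      also have "vecs u \<inter> {x \<in> S. matvec l u A x = y} = {x \<in> S. matvec l u A x = y}"
        using S by auto
      finally show ?thesis by (simp add: load_def)
    qed
    then show ?thesis by (simp add: fmean_def)
  qed
  have large: "exp r \<le> fmean l u g A" if A: "m \<le> real (max_load l u S A)" for A
  proof -
    have "max_load l u S A \<in> load l u S A ` vecs l"
      unfolding max_load_def using card_vecs[of l] by (intro Max_in) auto
    then obtain y where y: "y \<in> vecs l" "max_load l u S A = load l u S A y" by blast
    have "exp r * 2 ^ l \<le> a powr m" by (rule m)
    also have "\<dots> \<le> a powr real (load l u S A y)" using A a y by (intro powr_mono) auto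
    also have "\<dots> = a ^ load l u S A y" using a by (simp add: powr_realpow)
    also have "\<dots> \<le> (\<Sum>y\<in>vecs l. a ^ load l u S A y)"
      using a by (intro member_le_sum y) auto
    finally show ?thesis by (simp add: fmean_g field_simps)
  qed
  \<comment> \<open>The \<open>2 ^ l\<close> points of \<open>S\<close> cancel against the range of
    \<open>y\<close>. The remaining \<open>2 ^ u\<close> cancels the one in
    \<open>r / 2 ^ u\<close>, making the bound independent of \<open>u\<close>.\<close>
  have avg_g: "avg l u g - 1 = (a - 1) / 2 ^ u"
  proof -
    have "(\<Sum>y\<in>vecs l. \<Sum>x\<in>vecs u. g y x - 1)
        = (\<Sum>y\<in>vecs l. if y = (\<lambda>_. False) then (\<Sum>x\<in>vecs u. if x \<in> S then a - 1 else 0) else 0)"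
      by (intro sum.cong refl) (auto simp: g_def intro!: sum.cong sum.neutral)
    also have "\<dots> = (\<Sum>x\<in>vecs u. if x \<in> S then a - 1 else 0)"
      by (simp add: sum.delta') (simp add: vecs_def)
    also have "\<dots> = 2 ^ l * (a - 1)"
      using S by (simp add: sum.inter_restrict[symmetric] Int_absorb1)
    finally have "avg l u (\<lambda>y x. g y x - 1) = (a - 1) / 2 ^ u"
      by (simp add: avg_def power_add)
    then show ?thesis using avg_add[of l u "\<lambda>y x. g y x - 1" "\<lambda>_ _. 1"] by simp
  qed
  have "measure_pmf.prob (pmf_of_set (mats l u)) {A. m \<le> real (max_load l u S A)}
      \<le> measure_pmf.prob (pmf_of_set (mats l u)) {A. exp r \<le> fmean l u g A}"
    using large by (intro measure_pmf.finite_measure_mono) auto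
  also have "\<dots> = tail l (exp r) u g"
    by (simp add: measure_pmf_of_set mats_nonempty card_mats tail_def of_bool_def
        sum.If_cases Int_def)
  also have "\<dots> \<le> quad_coeff (r / 2 ^ u) * (avg l u g - 1)\<^sup>2"
    by (rule tail_le_quadratic[OF g r])
  also have "\<dots> \<le> (4 / (r / 2 ^ u)\<^sup>2) * (avg l u g - 1)\<^sup>2"
    proof -
    \<comment> \<open>The 4 is \<open>1 + 3\<close>, as \<open>3 / (1 + x)\<close> is at most 3 for
      positive \<open>x\<close>.\<close>
    have "0 < r / 2 ^ u" using r by simp
    then have "quad_coeff (r / 2 ^ u) \<le> 4 / (r / 2 ^ u)\<^sup>2"
      unfolding quad_coeff_def by (intro divide_right_mono) (auto simp: divide_le_eq)
    then show ?thesis by (rule mult_right_mono) simp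
  qed
  also have "\<dots> = 4 * (a - 1)\<^sup>2 / r\<^sup>2"
    using r by (simp add: avg_g power_divide)
  finally show ?thesis .
qed

theorem theorem3p6:
  "\<exists>C::real. C > 0 \<and> (\<exists>D::real. D > 0 \<and> (\<exists>l0::nat.
     \<forall>(l::nat) (u::nat) (S :: (nat \<Rightarrow> bool) set) (R::real).
       l \<le> u \<longrightarrow> S \<subseteq> vecs u \<longrightarrow> card S = 2 ^ l \<longrightarrow>
       R > 1 \<longrightarrow> R * real l powr (1 - 1 / R) \<ge> D * ln (real l) \<longrightarrow> l \<ge> l0 \<longrightarrow>
       measure_pmf.prob (pmf_of_set (mats l u))
         {A. real (max_load l u S A) \<ge> R * real l / log 2 (real l)}
       \<le> C * (ln (real l))\<^sup>2 / (R\<^sup>2 * real l powr (2 - 2 / R))))"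
proof -
  define C :: real where "C = 4 * (exp 1)\<^sup>2 / (ln 2)\<^sup>2"
  have bound: "measure_pmf.prob (pmf_of_set (mats l u))
         {A. real (max_load l u S A) \<ge> R * real l / log 2 (real l)}
       \<le> C * (ln (real l))\<^sup>2 / (R\<^sup>2 * real l powr (2 - 2 / R))"
    if S: "S \<subseteq> vecs u" "card S = 2 ^ l" and R: "R > 1" and l: "l \<ge> 2"
    for l u :: nat and S and R :: real
  proof -
    define r where "r = R * real l / log 2 (real l)"
    \<comment> \<open>Chosen so that \<open>ln a = 1 + ln l / R\<close>: in \<open>a powr r\<close>
      the 1 yields \<open>exp r\<close>, and \<open>r * ln l / R = l * ln 2\<close> yields
      \<open>2 ^ l\<close>.\<close>
    define a where "a = exp 1 * real l powr (1 / R)"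
    have ln: "0 < ln (real l)" using l by simp
    have r: "0 < r" using R l by (simp add: r_def)
    have r_eq: "r = R * real l * ln 2 / ln (real l)" by (simp add: r_def log_def)
    have "1 \<le> real l powr (1 / R)" using l R by (intro ge_one_powr_ge_zero) auto
    then have a: "1 \<le> a" using mult_mono[of 1 "exp (1::real)" 1 "real l powr (1 / R)"] by (simp add: a_def)
    have "a powr r = exp (r + real l * ln 2)"
      using l R ln by (simp add: powr_def a_def ln_mult r_eq distrib_left)
    also have "\<dots> = exp r * 2 ^ l"
      by (simp add: exp_add exp_of_nat_mult)
    finally have "exp r * 2 ^ l \<le> a powr r" by simp
    from prob_max_load_ge[OF S a r this]
    have "measure_pmf.prob (pmf_of_set (mats l u)) {A. r \<le> real (max_load l u S A)}
        \<le> 4 * (a - 1)\<^sup>2 / r\<^sup>2" .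
    also have "\<dots> \<le> 4 * a\<^sup>2 / r\<^sup>2"
      using a by (intro divide_right_mono mult_left_mono power_mono) auto
    also have "\<dots> = C * (ln (real l))\<^sup>2 / (R\<^sup>2 * real l powr (2 - 2 / R))"
    proof -
      have "(real l powr (1 / R))\<^sup>2 = real l powr (2 / R)"
        by (simp add: power2_eq_square flip: powr_add)
      moreover have "real l powr (2 - 2 / R) = (real l)\<^sup>2 / real l powr (2 / R)"
        using l by (simp add: powr_diff powr_numeral)
      ultimately show ?thesis
        using l R ln by (simp add: C_def a_def r_eq power_mult_distrib power_divide mult_ac)
    qed
    finally show ?thesis by (simp add: r_def)
  qed
  have "0 < C" by (simp add: C_def)
  then show ?thesis
    using bound by (intro exI[of _ C] conjI exI[of _ "1::real"] exI[of _ "2::nat"]) auto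
qed

end
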